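(* Let $G=(V,E)$ and $G'=(V,E')$ be two directed graphs on the same vertex set $V$. Then $G$ and $G'$ are distribution equivalent (that is, $\mathcal P(G)=\mathcal P(G')$) if and only if $G'=\pi(G)$ for some permutation $\pi$ of $V$ that factors according to vertex-disjoint cycles in $G$. Moreover, if $\pi$ is such a permutation (with $G'=\pi(G)$), then, given $\Lambda\in\mathbb R^E_*$ and a noise vector $\varepsilon$ with independent components for the model corresponding to $G$, the permutation $\pi$ uniquely determines a coefficient matrix $\Lambda'\in\mathbb R^{E'}_*$ and a noise vector $\varepsilon'$ with independent components for the model given by $G'$ such that $$X':=(I-\Lambda')^{-T}\varepsilon' =_d (I-\Lambda)^{-T}\varepsilon=:X,$$ where $=_d$ denotes equality in distribution.
   Context: Directed graphs are finite and have no self-loops; they may contain directed cycles, including 2-cycles $i\to j\to i$. For $G=(V,E)$, $\mathbb R^E$ is the set of real $|V|\times|V|$ matrices $\Lambda=(\lambda_{ij})_{i,j\in V}$ with $I-\Lambda$ invertible and $\lambda_{ij}=0$ whenever $i\to j\notin E$; $\mathbb R^E_*$ is the subset of those $\Lambda\in\mathbb R^E$ with moreover $\lambda_{ij}\neq0$ for every $i\to j\in E$. We write $M^{-T}=(M^{-1})^T$. A noise vector $\varepsilon=(\varepsilon_i)_{i\in V}$ is a centered random vector with mutually independent, nondegenerate, non-Gaussian components. $\mathcal P(G)$ is the set of all distributions of random vectors $X=(I-\Lambda)^{-T}\varepsilon$ (equivalently, solutions of $X=\Lambda^TX+\varepsilon$, i.e. of the structural equations $X_i=\sum_{j:\,j\to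 i\in E}\lambda_{ji}X_j+\varepsilon_i$) with $\Lambda\in\mathbb R^E_*$ and $\varepsilon$ a noise vector. $G$ and $G'$ are distribution equivalent if $\mathcal P(G)=\mathcal P(G')$. A permutation $\pi$ of $V$ factors according to vertex-disjoint cycles in $G$ if for every nontrivial cycle $(i_1\ i_2\ \cdots\ i_s)$ in the disjoint cycle decomposition of $\pi$ (so $\pi(i_1)=i_2$, etc.), the directed cycle $i_1\to i_2\to\cdots\to i_s\to i_1$ is in $G$. Such a $\pi$ determines a directed graph $\pi(G)=(V,\pi(E))$ as follows, for $i\ne j$: (i) if $i=\pi(j)$, then $i\to j\in\pi(E)$; (ii) if $i\neq\pi(j)$, then $i\to j\in\pi(E)$ if and only if $i\to\pi(j)\in E$. The sense in which $\pi$ determines $(\Lambda',\varepsilon')$ from $(\Lambda,\varepsilon)$ is by rearranging the structural equations: for each $j\in V$ with $\pi(j)\neq j$, the structural equation with left-hand side $X_{\pi(j)}$ is solved for $X_j$ (dividing by $\lambda_{j\pi(j)}$), and for $\pi(j)=j$ the equation for $X_j$ is kept. *)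

theory Defs
  imports "HOL-Probability.Probability"
begin

section \<open>Linear non-Gaussian structural equation models of directed graphs\<close>

text \<open>
  The vertex set is a finite type; a directed graph is its edge set \<open>E\<close>, where \<open>(i, j) \<in> E\<close> means
  \<open>i \<rightarrow> j\<close>. That there are no self-loops is the hypothesis \<^term>\<open>irrefl E\<close> wherever it is needed.
\<close>

subsection \<open>Coefficient matrices\<close>

definition coeff_matrices :: "('v::finite) rel \<Rightarrow> (real^'v^'v) set" where
  "coeff_matrices E =
     {\<Lambda>. invertible (mat 1 - \<Lambda>) \<and> (\<forall>i j. (i, j) \<notin> E \<longrightarrow> \<Lambda> $ i $ j = 0)}"

definition coeff_matrices_star :: "('v::finite) rel \<Rightarrow> (real^'v^'v) set" where
  "coeff_matrices_star E =
     {\<Lambda> \<in> coeff_matrices E. \<forall>i j. (i, j) \<in> E \<longrightarrow> \<Lambda> $ i $ j \<noteq> 0}"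

subsection \<open>Noise vectors\<close>

definition degenerate_rv :: "'a measure \<Rightarrow> ('a \<Rightarrow> real) \<Rightarrow> bool" where
  "degenerate_rv M Y \<longleftrightarrow> (\<exists>c. AE \<omega> in M. Y \<omega> = c)"

definition gaussian_rv :: "'a measure \<Rightarrow> ('a \<Rightarrow> real) \<Rightarrow> bool" where
  "gaussian_rv M Y \<longleftrightarrow> (\<exists>\<mu> \<sigma>. \<sigma> > 0 \<and> distributed M lborel Y (normal_density \<mu> \<sigma>))"

text \<open>Centered means that every component has a finite expectation, equal to \<open>0\<close>.\<close>

definition noise_vector :: "'a measure \<Rightarrow> ('a \<Rightarrow> real^'v::finite) \<Rightarrow> bool" where
  "noise_vector M \<epsilon> \<longleftrightarrow>
     prob_space M \<and>
     \<epsilon> \<in> borel_measurable M \<and>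
     prob_space.indep_vars M (\<lambda>_. borel) (\<lambda>i \<omega>. \<epsilon> \<omega> $ i) UNIV \<and>
     (\<forall>i. integrable M (\<lambda>\<omega>. \<epsilon> \<omega> $ i) \<and> (\<integral>\<omega>. \<epsilon> \<omega> $ i \<partial>M) = 0) \<and>
     (\<forall>i. \<not> degenerate_rv M (\<lambda>\<omega>. \<epsilon> \<omega> $ i)) \<and>
     (\<forall>i. \<not> gaussian_rv M (\<lambda>\<omega>. \<epsilon> \<omega> $ i))"

subsection \<open>The model of a graph\<close>

definition sem_solution :: "real^'v^'v \<Rightarrow> ('a \<Rightarrow> real^'v) \<Rightarrow> 'a \<Rightarrow> real^('v::finite)" where
  "sem_solution \<Lambda> \<epsilon> \<omega> = transpose (matrix_inv (mat 1 - \<Lambda>)) *v \<epsilon> \<omega>"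

text \<open>
  A set cannot range over probability spaces on all types, so the sample space here is \<open>real^'v\<close>
  itself. By \<open>sem_solution_in_model\<close> below, noise vectors on arbitrary probability spaces yield no
  further distributions.
\<close>

definition model :: "('v::finite) rel \<Rightarrow> (real^'v) measure set" where
  "model E =
     {distr M borel (sem_solution \<Lambda> \<epsilon>) | (M :: (real^'v) measure) \<epsilon> \<Lambda>.
        \<Lambda> \<in> coeff_matrices_star E \<and> noise_vector M \<epsilon>}"

definition distribution_equivalent :: "('v::finite) rel \<Rightarrow> 'v rel \<Rightarrow> bool" where
  "distribution_equivalent E E' \<longleftrightarrow> model E = model E'"

lemma noise_vector_distr:
  fixes \<epsilon> :: "'a \<Rightarrow> real^'v::finite"
  assumes "noise_vector M \<epsilon>"
  shows "noise_vector (distr M borel \<epsilon>) (\<lambda>e. e)"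
proof -
  interpret M: prob_space M
    using assms by (simp add: noise_vector_def)
  have meas [measurable]: "\<epsilon> \<in> borel_measurable M"
    using assms by (simp add: noise_vector_def)
  interpret D: prob_space "distr M borel \<epsilon>"
    by (rule M.prob_space_distr) simp
  have comp [measurable]: "(\<lambda>e. e $ i) \<in> borel_measurable borel" for i :: 'v
    by (intro borel_measurable_continuous_onI continuous_intros)
  have "D.indep_vars (\<lambda>_. borel) (\<lambda>i e. e $ i) UNIV"
  proof (subst D.indep_vars_iff_distr_eq_PiM)
    have ind: "M.indep_vars (\<lambda>_. borel) (\<lambda>i \<omega>. \<epsilon> \<omega> $ i) UNIV"
      using assms by (simp add: noise_vector_def)
    have "distr (distr M borel \<epsilon>) (Pi\<^sub>M UNIV (\<lambda>_. borel)) (\<lambda>x. \<lambda>i\<in>UNIV. x $ i) =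
        distr M (Pi\<^sub>M UNIV (\<lambda>_. borel)) (\<lambda>x. \<lambda>i\<in>UNIV. \<epsilon> x $ i)"
      by (subst distr_distr) (auto simp: comp_def intro!: measurable_restrict)
    also have "\<dots> = Pi\<^sub>M UNIV (\<lambda>i. distr M borel (\<lambda>\<omega>. \<epsilon> \<omega> $ i))"
      using ind by (subst (asm) M.indep_vars_iff_distr_eq_PiM) auto
    also have "\<dots> = Pi\<^sub>M UNIV (\<lambda>i. distr (distr M borel \<epsilon>) borel (\<lambda>e. e $ i))"
      by (intro PiM_cong refl) (subst distr_distr, auto simp: comp_def)
    finally show "distr (distr M borel \<epsilon>) (Pi\<^sub>M UNIV (\<lambda>_. borel)) (\<lambda>x. \<lambda>i\<in>UNIV. x $ i) =
        Pi\<^sub>M UNIV (\<lambda>i. distr (distr M borel \<epsilon>) borel (\<lambda>e. e $ i))" .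
  qed auto
  moreover have "degenerate_rv (distr M borel \<epsilon>) (\<lambda>e. e $ i) \<longleftrightarrow>
      degenerate_rv M (\<lambda>\<omega>. \<epsilon> \<omega> $ i)" for i
    unfolding degenerate_rv_def by (subst AE_distr_iff) auto
  moreover have "gaussian_rv (distr M borel \<epsilon>) (\<lambda>e. e $ i) \<longleftrightarrow>
      gaussian_rv M (\<lambda>\<omega>. \<epsilon> \<omega> $ i)" for i
    unfolding gaussian_rv_def distributed_def by (subst distr_distr) (auto simp: comp_def)
  ultimately show ?thesis
    using assms D.prob_space_axioms
    by (auto simp: noise_vector_def integrable_distr_eq integral_distr)
qed

lemma sem_solution_in_model:
  fixes \<epsilon> :: "'a \<Rightarrow> real^'v::finite"
  assumes "\<Lambda> \<in> coeff_matrices_star E" "noise_vector M \<epsilon>"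
  shows "distr M borel (sem_solution \<Lambda> \<epsilon>) \<in> model E"
proof -
  have [measurable]: "\<epsilon> \<in> borel_measurable M"
    using assms(2) by (simp add: noise_vector_def)
  have "sem_solution \<Lambda> (\<lambda>e. e) \<in> borel_measurable (borel :: (real^'v) measure)"
    unfolding sem_solution_def [abs_def]
    by (intro borel_measurable_continuous_onI matrix_vector_mult_linear_continuous_on)
  then have "distr M borel (sem_solution \<Lambda> \<epsilon>) =
      distr (distr M borel \<epsilon>) borel (sem_solution \<Lambda> (\<lambda>e. e))"
    by (subst distr_distr) (auto simp: comp_def sem_solution_def [abs_def])
  then show ?thesis
    using assms(1) noise_vector_distr [OF assms(2)] by (auto simp: model_def)
qed

subsection \<open>Permutations acting on graphs\<close>

text \<open>
  A cycle \<open>(i\<^sub>1 i\<^sub>2 \<dots> i\<^sub>s)\<close> is the list of its entries, whose successors are listed by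
  \<^const>\<open>rotate1\<close>.
\<close>

definition nontrivial_cycle_of :: "('v \<Rightarrow> 'v) \<Rightarrow> 'v list \<Rightarrow> bool" where
  "nontrivial_cycle_of \<pi> cs \<longleftrightarrow> distinct cs \<and> length cs \<ge> 2 \<and> map \<pi> cs = rotate1 cs"

definition directed_cycle_in :: "'v rel \<Rightarrow> 'v list \<Rightarrow> bool" where
  "directed_cycle_in E cs \<longleftrightarrow>
     distinct cs \<and> length cs \<ge> 2 \<and> set (zip cs (rotate1 cs)) \<subseteq> E"

definition factors_by_cycles :: "('v \<Rightarrow> 'v) \<Rightarrow> 'v rel \<Rightarrow> bool" where
  "factors_by_cycles \<pi> E \<longleftrightarrow>
     \<pi> permutes UNIV \<and> (\<forall>cs. nontrivial_cycle_of \<pi> cs \<longrightarrow> directed_cycle_in E cs)"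

definition perm_graph :: "('v \<Rightarrow> 'v) \<Rightarrow> 'v rel \<Rightarrow> 'v rel" where
  "perm_graph \<pi> E = {(i, j). i \<noteq> j \<and> (i = \<pi> j \<or> (i \<noteq> \<pi> j \<and> (i, \<pi> j) \<in> E))}"

subsection \<open>Rearranging the structural equations\<close>

text \<open>The right-hand side of the structural equation for \<open>X\<^sub>i\<close>, with noise value \<open>e\<close>.\<close>

definition structural_rhs :: "real^'v^'v \<Rightarrow> real^'v \<Rightarrow> 'v::finite \<Rightarrow> real^'v \<Rightarrow> real" where
  "structural_rhs \<Lambda> e i x = (\<Sum>k\<in>UNIV. \<Lambda> $ k $ i * x $ k) + e $ i"

text \<open>
  The right-hand side obtained by solving the structural equation with left-hand side \<open>X\<^sub>i\<close>
  for \<open>X\<^sub>j\<close>, where \<open>j \<noteq> i\<close>.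
\<close>

definition solved_rhs :: "real^'v^'v \<Rightarrow> real^'v \<Rightarrow> 'v::finite \<Rightarrow> 'v \<Rightarrow> real^'v \<Rightarrow> real" where
  "solved_rhs \<Lambda> e i j x =
     (x $ i - (\<Sum>k\<in>UNIV - {j}. \<Lambda> $ k $ i * x $ k) - e $ i) / \<Lambda> $ j $ i"

text \<open>
  The right-hand sides are compared as functions of the unrestricted variables \<open>x\<close>, i.e. coefficient
  by coefficient, and not only at the solution of the equations.
\<close>

definition rearranged_equations ::
  "'a measure \<Rightarrow> ('v \<Rightarrow> 'v) \<Rightarrow> real^'v^'v \<Rightarrow> ('a \<Rightarrow> real^'v) \<Rightarrow> real^'v^'v \<Rightarrow> ('a \<Rightarrow> real^'v::finite) \<Rightarrow> bool"
where
  "rearranged_equations M \<pi> \<Lambda> \<epsilon> \<Lambda>' \<epsilon>' \<longleftrightarrow>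
     (\<forall>\<omega>\<in>space M. \<forall>j x. structural_rhs \<Lambda>' (\<epsilon>' \<omega>) j x =
        (if \<pi> j = j then structural_rhs \<Lambda> (\<epsilon> \<omega>) j x else solved_rhs \<Lambda> (\<epsilon> \<omega>) (\<pi> j) j x))"

end

theory Submission
  imports Defs "HOL-Combinatorics.Cycles"
begin

text \<open>
  Rearranging the structural equations along \<open>\<pi>\<close> replaces \<open>I - \<Lambda>\<close> by a matrix whose columns are rescaled
  and permuted columns of \<open>I - \<Lambda>\<close>; this shows \<open>P(G) \<subseteq> P(\<pi>(G))\<close>, and the reverse inclusion follows
  because \<open>\<pi>\<^sup>-\<^sup>1\<close> takes \<open>\<pi>(G)\<close> back to \<open>G\<close>.

  For the converse, the noise may be chosen at will, so general identifiability results on independent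
  components are not needed. Take independent random signs as noise for \<open>G\<close>. If the resulting
  distribution also lies in \<open>P(G')\<close>, then \<open>A = (I - \<Lambda>')\<^sup>T (I - \<Lambda>)\<^sup>-\<^sup>T\<close> maps the random signs to a vector
  with independent components. Comparing the extreme values of the rows shows that distinct rows of \<open>A\<close>
  have disjoint supports, so \<open>A\<close> is a permutation matrix up to scaling of its rows, and the zero
  patterns of \<open>I - \<Lambda>\<close> and \<open>I - \<Lambda>'\<close> give the cycles in \<open>G\<close> and \<open>G' = \<pi>(G)\<close>.
\<close>

section \<open>Permutations factoring through cycles\<close>

text \<open>Replaces cycles by single points: the cycle through a moved point \<open>j\<close> is
  its orbit, whose first step is \<open>j\<close> to \<open>\<pi> j\<close>, and every step of a
  nontrivial cycle is of this kind.\<close>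

lemma factors_by_cycles_iff:
  fixes \<pi> :: "'v::finite \<Rightarrow> 'v"
  shows "factors_by_cycles \<pi> E \<longleftrightarrow> bij \<pi> \<and> (\<forall>j. \<pi> j \<noteq> j \<longrightarrow> (j, \<pi> j) \<in> E)"
proof
  assume f: "factors_by_cycles \<pi> E"
  then have perm: "permutation \<pi>" and "bij \<pi>"
    by (auto simp: factors_by_cycles_def permutation_permutes permutes_bij)
  have "(j, \<pi> j) \<in> E" if "\<pi> j \<noteq> j" for j
  proof -
    define n where "n = least_power \<pi> j"
    have n: "n > 1" "(\<pi> ^^ n) j = j"
      using least_power_gt_one[OF perm that] least_power_of_permutation[OF perm, of j]
      by (auto simp: n_def)
    have "map \<pi> (support \<pi> j) = rotate1 (support \<pi> j)"
    proof (rule nth_equalityI)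
      fix i assume "i < length (map \<pi> (support \<pi> j))"
      then have i: "i < n" by (simp add: n_def)
      \<comment> \<open>At the last index the rotated list wraps around to its head; the period
        \<open>n\<close> of \<open>j\<close> makes the iterates wrap in the same way.\<close>
      have "(\<pi> ^^ (Suc i mod n)) j = (\<pi> ^^ Suc i) j"
        using funpow_mod_eq[OF n(2), of "Suc i"] .
      then show "map \<pi> (support \<pi> j) ! i = rotate1 (support \<pi> j) ! i"
        using i n by (simp add: nth_rotate1 flip: n_def)
    qed simp
    then have "nontrivial_cycle_of \<pi> (support \<pi> j)"
      using cycle_of_permutation[OF perm, of j] n(1)
      by (simp add: nontrivial_cycle_of_def flip: n_def)
    then have sub: "set (zip (support \<pi> j) (map \<pi> (support \<pi> j))) \<subseteq> E"
      using f by (auto simp: factors_by_cycles_def directed_cycle_in_def nontrivial_cycle_of_def)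
    have "(j, \<pi> j) = zip (support \<pi> j) (map \<pi> (support \<pi> j)) ! 0"
      using n by (simp flip: n_def)
    also have "\<dots> \<in> set (zip (support \<pi> j) (map \<pi> (support \<pi> j)))"
      by (rule nth_mem) (use n in \<open>simp flip: n_def\<close>)
    finally show ?thesis using sub by blast
  qed
  with \<open>bij \<pi>\<close> show "bij \<pi> \<and> (\<forall>j. \<pi> j \<noteq> j \<longrightarrow> (j, \<pi> j) \<in> E)" by blast
next
  assume r: "bij \<pi> \<and> (\<forall>j. \<pi> j \<noteq> j \<longrightarrow> (j, \<pi> j) \<in> E)"
  have "directed_cycle_in E cs" if cs: "nontrivial_cycle_of \<pi> cs" for cs
  proof -
    have d: "distinct cs" "length cs \<ge> 2" "map \<pi> cs = rotate1 cs"
      using cs by (auto simp: nontrivial_cycle_of_def)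
    have "(cs ! i, \<pi> (cs ! i)) \<in> E" if i: "i < length cs" for i
    proof -
      have "\<pi> (cs ! i) = cs ! (Suc i mod length cs)"
        using arg_cong[OF d(3), of "\<lambda>xs. xs ! i"] i by (simp add: nth_rotate1)
      \<comment> \<open>Length at least 2 makes the cyclic successor a different index, so by
        distinctness \<open>\<pi>\<close> moves the entry.\<close>
      moreover have "Suc i mod length cs \<noteq> i"
        using i d(2) by (cases "Suc i = length cs") auto
      moreover have "Suc i mod length cs < length cs" using i by (intro mod_less_divisor) auto
      ultimately have "\<pi> (cs ! i) \<noteq> cs ! i"
        using d(1) i by (simp add: nth_eq_iff_index_eq)
      with r show ?thesis by blast
    qed
    then have "set (zip cs (map \<pi> cs)) \<subseteq> E"
      by (auto simp: set_zip)
    then show ?thesis using d by (simp add: directed_cycle_in_def)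
  qed
  with r show "factors_by_cycles \<pi> E"
    by (auto simp: factors_by_cycles_def bij_iff permutes_univ)
qed

text \<open>In \<open>perm_graph \<pi> E\<close> clause (i) reverses each cycle of
  \<open>\<pi>\<close>, which is what \<open>inv \<pi>\<close> requires. Going back, clause (i) for
  \<open>inv \<pi>\<close> restores exactly the edges from \<open>i\<close> to
  \<open>\<pi> i\<close>, which lie in \<open>E\<close> by the cycle condition; for the other edges
  the two shifts of the head cancel.\<close>

lemma factors_by_cycles_inv_perm_graph:
  fixes E :: "'v::finite rel"
  assumes "irrefl E" "factors_by_cycles \<pi> E"
  shows "factors_by_cycles (inv \<pi>) (perm_graph \<pi> E)"
    and "perm_graph (inv \<pi>) (perm_graph \<pi> E) = E"
proof -
  have b: "bij \<pi>" and e: "\<pi> j \<noteq> j \<Longrightarrow> (j, \<pi> j) \<in> E" for j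
    using assms(2) by (auto simp: factors_by_cycles_iff)
  have [simp]: "\<pi> (inv \<pi> j) = j" "inv \<pi> (\<pi> j) = j" for j
    using b by (auto simp: bij_is_inj bij_is_surj surj_f_inv_f)
  show "factors_by_cycles (inv \<pi>) (perm_graph \<pi> E)"
    using b by (auto simp: factors_by_cycles_iff bij_imp_bij_inv perm_graph_def)
  have "(i, j) \<in> perm_graph (inv \<pi>) (perm_graph \<pi> E) \<longleftrightarrow> (i, j) \<in> E" for i j
  proof (cases "i = j")
    case True
    then show ?thesis using assms(1) by (auto simp: perm_graph_def irrefl_def)
  next
    case False
    then show ?thesis
      using e[of i] by (cases "i = inv \<pi> j") (auto simp: perm_graph_def)
  qed
  then show "perm_graph (inv \<pi>) (perm_graph \<pi> E) = E" by auto
qed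

section \<open>Rearranging the equations\<close>

lemma matrix_inv_mult:
  assumes "invertible A"
  shows "A ** matrix_inv A = mat 1" "matrix_inv A ** A = mat 1"
  using someI_ex[OF assms [unfolded invertible_def]] by (simp_all add: matrix_inv_def)

lemma sem_solution_eq_iff:
  assumes "invertible (mat 1 - \<Lambda>)"
  shows "sem_solution \<Lambda> \<epsilon> \<omega> = x \<longleftrightarrow> transpose (mat 1 - \<Lambda>) *v x = \<epsilon> \<omega>"
proof -
  have "transpose (mat 1 - \<Lambda>) ** transpose (matrix_inv (mat 1 - \<Lambda>)) = mat 1"
    "transpose (matrix_inv (mat 1 - \<Lambda>)) ** transpose (mat 1 - \<Lambda>) = mat 1"
    using assms by (simp_all add: matrix_inv_mult transpose_mat flip: matrix_transpose_mul)
  then show ?thesis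
    unfolding sem_solution_def by (metis matrix_vector_mul_assoc matrix_vector_mul_lid)
qed

section \<open>Measurability, and noise vectors under permutation and rescaling\<close>

lemma borel_measurable_vec_lambda:
  fixes f :: "'a \<Rightarrow> 'v::finite \<Rightarrow> real"
  assumes "\<And>i. (\<lambda>\<omega>. f \<omega> i) \<in> borel_measurable M"
  shows "(\<lambda>\<omega>. \<chi> i. f \<omega> i) \<in> borel_measurable M"
  using assms by (subst borel_measurable_euclidean_space) (auto simp: Basis_vec_def inner_axis)

lemma borel_measurable_vec_nth:
  fixes f :: "'a \<Rightarrow> real^'v::finite"
  assumes "f \<in> borel_measurable M"
  shows "(\<lambda>\<omega>. f \<omega> $ i) \<in> borel_measurable M"
proof -
  have "(\<lambda>x. x $ i) \<in> borel_measurable (borel :: (real^'v) measure)"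
    by (intro borel_measurable_continuous_onI continuous_intros)
  from measurable_compose[OF assms this] show ?thesis .
qed

lemma borel_measurable_matrix_vector_mult:
  fixes A :: "real^'v^'w"
  shows "(\<lambda>x. A *v x) \<in> borel_measurable borel"
  by (intro borel_measurable_continuous_onI matrix_vector_mult_linear_continuous_on)

lemma (in prob_space) indep_vars_reindex:
  assumes "indep_vars N X I" "inj_on f J" "f ` J \<subseteq> I"
  shows "indep_vars (\<lambda>j. N (f j)) (\<lambda>j. X (f j)) J"
  unfolding indep_vars_def2
proof (intro conjI ballI indep_setsI)
  fix j assume "j \<in> J"
  then show "random_variable (N (f j)) (X (f j))"
    using assms by (auto simp: indep_vars_def2)
  show "{X (f j) -` A \<inter> space M |A. A \<in> sets (N (f j))} \<subseteq> events"
    using \<open>random_variable (N (f j)) (X (f j))\<close> by auto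
next
  fix A K assume K: "K \<noteq> {}" "K \<subseteq> J" "finite K"
    and "\<forall>j\<in>K. A j \<in> {X (f j) -` A \<inter> space M |A. A \<in> sets (N (f j))}"
  then obtain B where B: "\<And>j. j \<in> K \<Longrightarrow> B j \<in> sets (N (f j)) \<and> A j = X (f j) -` B j \<inter> space M"
    by simp metis
  have inj: "inj_on f K" using assms(2) K(2) by (rule inj_on_subset)
  define C where "C i = B (the_inv_into K f i)" for i
  have C: "C (f j) = B j" if "j \<in> K" for j
    using inj that by (simp add: C_def the_inv_into_f_f)
  have "prob (\<Inter>i\<in>f ` K. X i -` C i \<inter> space M) = (\<Prod>i\<in>f ` K. prob (X i -` C i \<inter> space M))"
    using K assms(3) B C by (intro indep_varsD[OF assms(1)]) auto
  then show "prob (\<Inter>j\<in>K. A j) = (\<Prod>j\<in>K. prob (A j))"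
    using inj B C \<open>K \<noteq> {}\<close> by (simp add: prod.reindex)
qed

lemma noise_vector_permute_scale:
  fixes \<epsilon> :: "'a \<Rightarrow> real^'v::finite"
  assumes \<epsilon>: "noise_vector M \<epsilon>" and "bij \<pi>" and c: "\<And>j. c j \<noteq> 0"
  shows "noise_vector M (\<lambda>\<omega>. \<chi> j. \<epsilon> \<omega> $ \<pi> j / c j)"
proof -
  interpret prob_space M using \<epsilon> by (simp add: noise_vector_def)
  have m: "(\<lambda>\<omega>. \<epsilon> \<omega> $ i) \<in> borel_measurable M" for i
    using \<epsilon> by (intro borel_measurable_vec_nth) (simp add: noise_vector_def)
  have "indep_vars (\<lambda>_. borel) (\<lambda>i \<omega>. \<epsilon> \<omega> $ i) UNIV"
    using \<epsilon> by (simp add: noise_vector_def)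
  then have "indep_vars (\<lambda>_. borel) (\<lambda>j \<omega>. \<epsilon> \<omega> $ \<pi> j) UNIV"
    by (rule indep_vars_reindex) (use \<open>bij \<pi>\<close> in \<open>auto simp: bij_def\<close>)
  then have "indep_vars (\<lambda>_. borel) (\<lambda>j \<omega>. \<epsilon> \<omega> $ \<pi> j / c j) UNIV"
    by (rule indep_vars_compose2) simp
  moreover have "\<not> degenerate_rv M (\<lambda>\<omega>. \<epsilon> \<omega> $ \<pi> j / c j)" for j
  proof
    assume "degenerate_rv M (\<lambda>\<omega>. \<epsilon> \<omega> $ \<pi> j / c j)"
    then obtain d where "AE \<omega> in M. \<epsilon> \<omega> $ \<pi> j / c j = d" by (auto simp: degenerate_rv_def)
    then have "AE \<omega> in M. \<epsilon> \<omega> $ \<pi> j = d * c j"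
      by eventually_elim (use c in \<open>auto simp: field_simps\<close>)
    then show False using \<epsilon> by (auto simp: noise_vector_def degenerate_rv_def)
  qed
  moreover have "\<not> gaussian_rv M (\<lambda>\<omega>. \<epsilon> \<omega> $ \<pi> j / c j)" for j
  proof
    assume "gaussian_rv M (\<lambda>\<omega>. \<epsilon> \<omega> $ \<pi> j / c j)"
    then obtain \<mu> \<sigma> where "\<sigma> > 0"
      and g: "distributed M lborel (\<lambda>\<omega>. \<epsilon> \<omega> $ \<pi> j / c j) (normal_density \<mu> \<sigma>)"
      by (auto simp: gaussian_rv_def)
    \<comment> \<open>Undoing the division is an affine map with shift 0, which would turn a
      Gaussian quotient into a Gaussian component of \<open>\<epsilon>\<close>.\<close>
    have "distributed M lborel (\<lambda>\<omega>. \<epsilon> \<omega> $ \<pi> j)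
        (normal_density (0 + c j * \<mu>) (\<bar>c j\<bar> * \<sigma>))"
      using normal_density_affine[OF g \<open>\<sigma> > 0\<close> c[of j], of 0] c[of j] by simp
    moreover have "\<bar>c j\<bar> * \<sigma> > 0" using c \<open>\<sigma> > 0\<close> by simp
    ultimately show False using \<epsilon> by (auto simp: noise_vector_def gaussian_rv_def)
  qed
  ultimately show ?thesis
    using \<epsilon> m c by (auto simp: noise_vector_def intro!: borel_measurable_vec_lambda)
qed

text \<open>
  Dividing by the entry \<open>(j, \<pi> j)\<close> of \<open>I - \<Lambda>\<close>, which is \<open>- \<Lambda> $ j $ \<pi> j\<close> or \<open>1\<close>, is what solving for \<open>X\<^sub>j\<close> does.
\<close>

definition rearranged_coeffs :: "('v \<Rightarrow> 'v) \<Rightarrow> real^'v^'v \<Rightarrow> real^'v^'v::finite" where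
  "rearranged_coeffs \<pi> \<Lambda> =
     mat 1 - (\<chi> i j. (mat 1 - \<Lambda>) $ i $ \<pi> j / (mat 1 - \<Lambda>) $ j $ \<pi> j)"

definition rearranged_noise ::
  "('v \<Rightarrow> 'v) \<Rightarrow> real^'v^'v \<Rightarrow> ('a \<Rightarrow> real^'v) \<Rightarrow> 'a \<Rightarrow> real^'v::finite" where
  "rearranged_noise \<pi> \<Lambda> \<epsilon> \<omega> = (\<chi> j. \<epsilon> \<omega> $ \<pi> j / (mat 1 - \<Lambda>) $ j $ \<pi> j)"

text \<open>The outer \<open>mat 1 -\<close> cancels the one in \<open>rearranged_coeffs\<close>.
  Invertibility and equality of the solutions are both read off from this form.\<close>

lemma transpose_rearranged_coeffs_mult:
  "transpose (mat 1 - rearranged_coeffs \<pi> \<Lambda>) *v x =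
     (\<chi> j. (transpose (mat 1 - \<Lambda>) *v x) $ \<pi> j / (mat 1 - \<Lambda>) $ j $ \<pi> j)"
  by (simp add: rearranged_coeffs_def vec_eq_iff matrix_vector_mult_def transpose_def
      sum_divide_distrib)

section \<open>The rearranged model: invertibility, zero pattern, solution and noise\<close>

context
  fixes E :: "'v::finite rel" and \<pi> \<Lambda>
  assumes irrefl: "irrefl E" and cycles: "factors_by_cycles \<pi> E"
    and \<Lambda>: "\<Lambda> \<in> coeff_matrices_star E"
begin

lemma star_zero_iff: "\<Lambda> $ i $ j = 0 \<longleftrightarrow> (i, j) \<notin> E"
  using \<Lambda> by (auto simp: coeff_matrices_star_def coeff_matrices_def)

lemma star_diagonal: "\<Lambda> $ i $ i = 0"
  using irrefl by (simp add: star_zero_iff irrefl_def)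

text \<open>At a fixed point the pivot is 1, because \<open>\<Lambda>\<close> has zero diagonal; at
  a moved point it is the negated coefficient of a cycle edge, nonzero in
  \<open>coeff_matrices_star E\<close>.\<close>

lemma pivot_nonzero: "(mat 1 - \<Lambda>) $ j $ \<pi> j \<noteq> 0"
  using cycles star_zero_iff[of j "\<pi> j"] by (cases "\<pi> j = j") (auto simp: mat_def star_diagonal factors_by_cycles_iff)

lemma invertible_rearranged_coeffs: "invertible (mat 1 - rearranged_coeffs \<pi> \<Lambda>)"
proof -
  have "x = 0" if "transpose (mat 1 - rearranged_coeffs \<pi> \<Lambda>) *v x = 0" for x
  proof -
    have "(transpose (mat 1 - \<Lambda>) *v x) $ \<pi> j = 0" for j
      using arg_cong[OF that, of "\<lambda>y. y $ j"] pivot_nonzero[of j]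
      by (simp add: transpose_rearranged_coeffs_mult del: transpose_matrix_vector)
    \<comment> \<open>Surjectivity makes the permuted equations exhaust all the original ones, so
      the kernel is that of the original system.\<close>
    moreover have "surj \<pi>" using cycles by (simp add: factors_by_cycles_iff bij_is_surj)
    ultimately have "transpose (mat 1 - \<Lambda>) *v x = 0"
      by (auto simp: vec_eq_iff) (metis surjD)
    moreover have "invertible (transpose (mat 1 - \<Lambda>))"
      using \<Lambda> by (simp add: coeff_matrices_star_def coeff_matrices_def transpose_invertible)
    ultimately show "x = 0"
      using matrix_left_invertible_ker invertible_left_inverse by blast
  qed
  then have "invertible (transpose (mat 1 - rearranged_coeffs \<pi> \<Lambda>))"
    using matrix_left_invertible_ker invertible_left_inverse by blast
  then show ?thesis using transpose_invertible by (metis transpose_transpose)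
qed

lemma rearranged_coeffs_star: "rearranged_coeffs \<pi> \<Lambda> \<in> coeff_matrices_star (perm_graph \<pi> E)"
proof -
  \<comment> \<open>For \<open>i = j\<close> the pivot divided by itself cancels the 1. Off the
    diagonal, \<open>i = \<pi> j\<close> meets a diagonal 1 of \<open>mat 1 - \<Lambda>\<close> and
    gives clause (i); otherwise the entry is a multiple of \<open>\<Lambda> $ i $ \<pi> j\<close>,
    giving clause (ii).\<close>
  have "rearranged_coeffs \<pi> \<Lambda> $ i $ j = 0 \<longleftrightarrow> (i, j) \<notin> perm_graph \<pi> E" for i j
    using pivot_nonzero[of j] star_zero_iff[of i "\<pi> j"]
    by (cases "i = \<pi> j"; cases "i = j") (auto simp: rearranged_coeffs_def perm_graph_def mat_def star_diagonal)
  then show ?thesis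
    using invertible_rearranged_coeffs by (auto simp: coeff_matrices_star_def coeff_matrices_def)
qed

lemma sem_solution_rearranged:
  "sem_solution (rearranged_coeffs \<pi> \<Lambda>) (rearranged_noise \<pi> \<Lambda> \<epsilon>) = sem_solution \<Lambda> \<epsilon>"
proof
  fix \<omega>
  have "transpose (mat 1 - \<Lambda>) *v sem_solution \<Lambda> \<epsilon> \<omega> = \<epsilon> \<omega>"
    using \<Lambda> by (subst sem_solution_eq_iff [symmetric])
      (auto simp: coeff_matrices_star_def coeff_matrices_def)
  then show "sem_solution (rearranged_coeffs \<pi> \<Lambda>) (rearranged_noise \<pi> \<Lambda> \<epsilon>) \<omega> = sem_solution \<Lambda> \<epsilon> \<omega>"
    by (simp add: sem_solution_eq_iff invertible_rearranged_coeffs transpose_rearranged_coeffs_mult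
        rearranged_noise_def del: transpose_matrix_vector)
qed

lemma noise_vector_rearranged:
  "noise_vector M \<epsilon> \<Longrightarrow> noise_vector M (rearranged_noise \<pi> \<Lambda> \<epsilon>)"
  unfolding rearranged_noise_def [abs_def]
  by (rule noise_vector_permute_scale)
    (use cycles pivot_nonzero in \<open>auto simp: factors_by_cycles_iff\<close>)

lemma rearranged_equations_rearranged:
  "rearranged_equations M \<pi> \<Lambda> \<epsilon> (rearranged_coeffs \<pi> \<Lambda>) (rearranged_noise \<pi> \<Lambda> \<epsilon>)"
  unfolding rearranged_equations_def
proof (intro ballI allI)
  fix \<omega> j and x :: "real^'v"
  define b where "b = (mat 1 - \<Lambda>) $ j $ \<pi> j"
  have [simp]: "(\<Sum>k\<in>UNIV. (mat 1 :: real^'v^'v) $ k $ i * x $ k) = x $ i" for i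
    by (simp add: mat_def if_distrib [of "\<lambda>u. u * _"] cong: if_cong)
  have "structural_rhs (rearranged_coeffs \<pi> \<Lambda>) (rearranged_noise \<pi> \<Lambda> \<epsilon> \<omega>) j x =
      x $ j - (\<Sum>k\<in>UNIV. (mat 1 - \<Lambda>) $ k $ \<pi> j / b * x $ k) + \<epsilon> \<omega> $ \<pi> j / b"
    by (simp add: structural_rhs_def rearranged_coeffs_def rearranged_noise_def b_def
        left_diff_distrib sum_subtractf)
  also have "(\<Sum>k\<in>UNIV. (mat 1 - \<Lambda>) $ k $ \<pi> j / b * x $ k) =
      (x $ \<pi> j - (\<Sum>k\<in>UNIV. \<Lambda> $ k $ \<pi> j * x $ k)) / b"
    by (simp add: left_diff_distrib sum_subtractf diff_divide_distrib flip: sum_divide_distrib)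
  also have "x $ j - (x $ \<pi> j - (\<Sum>k\<in>UNIV. \<Lambda> $ k $ \<pi> j * x $ k)) / b + \<epsilon> \<omega> $ \<pi> j / b =
      (if \<pi> j = j then structural_rhs \<Lambda> (\<epsilon> \<omega>) j x else solved_rhs \<Lambda> (\<epsilon> \<omega>) (\<pi> j) j x)"
  proof (cases "\<pi> j = j")
    case True
    then show ?thesis by (simp add: b_def structural_rhs_def mat_def star_diagonal)
  next
    case False
    \<comment> \<open>Because of this sign, the summand \<open>k = j\<close> divided by
      \<open>b\<close> cancels \<open>x $ j\<close>, leaving the equation solved for that
      variable.\<close>
    then have "b = - \<Lambda> $ j $ \<pi> j" by (simp add: b_def mat_def)
    moreover have "b \<noteq> 0" using pivot_nonzero by (simp add: b_def)
    moreover have "(\<Sum>k\<in>UNIV. \<Lambda> $ k $ \<pi> j * x $ k) =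
        \<Lambda> $ j $ \<pi> j * x $ j + (\<Sum>k\<in>UNIV - {j}. \<Lambda> $ k $ \<pi> j * x $ k)"
      by (rule sum.remove) auto
    ultimately show ?thesis
      using False by (simp add: solved_rhs_def field_simps)
  qed
  finally show "structural_rhs (rearranged_coeffs \<pi> \<Lambda>) (rearranged_noise \<pi> \<Lambda> \<epsilon> \<omega>) j x = \<dots>" .
qed

end

section \<open>Uniqueness of the rearranged model, and inclusion of models\<close>

lemma structural_rhs_inject:
  assumes "\<And>j x. structural_rhs \<Lambda> e j x = structural_rhs \<Lambda>' e' j x"
  shows "\<Lambda> = \<Lambda>'" "e = e'"
proof -
  \<comment> \<open>The argument 0 isolates the noise; the unit vectors below then isolate the
    coefficients.\<close>
  have e: "e $ j = e' $ j" for j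
    using assms[of j 0] by (simp add: structural_rhs_def)
  then show "e = e'" by (simp add: vec_eq_iff)
  have "\<Lambda> $ i $ j = \<Lambda>' $ i $ j" for i j
    using assms[of j "axis i 1"] e
    by (simp add: structural_rhs_def axis_def if_distrib [of "\<lambda>u. _ * u"] cong: if_cong)
  then show "\<Lambda> = \<Lambda>'" by (simp add: vec_eq_iff)
qed

text \<open>The right-hand sides are prescribed at each sample point, so they can be compared
  pointwise. The nonempty sample space supplies a point at which the coefficients are fixed.\<close>

lemma rearranged_equations_unique:
  assumes "prob_space M" "rearranged_equations M \<pi> \<Lambda> \<epsilon> \<Lambda>' \<epsilon>'"
    "rearranged_equations M \<pi> \<Lambda> \<epsilon> \<Lambda>'' \<epsilon>''"
  shows "\<Lambda>'' = \<Lambda>' \<and> (\<forall>\<omega>\<in>space M. \<epsilon>'' \<omega> = \<epsilon>' \<omega>)"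
proof -
  have "structural_rhs \<Lambda>'' (\<epsilon>'' \<omega>) j x = structural_rhs \<Lambda>' (\<epsilon>' \<omega>) j x" if "\<omega> \<in> space M" for \<omega> j x
    using assms(2,3) that by (simp add: rearranged_equations_def)
  then show ?thesis
    using structural_rhs_inject prob_space.not_empty[OF assms(1)] by blast
qed

text \<open>The rearranged pair has the same solution as a function on the same probability space,
  so in particular the same distribution.\<close>

lemma model_subset_perm_graph:
  assumes "irrefl E" "factors_by_cycles \<pi> E"
  shows "model E \<subseteq> model (perm_graph \<pi> E)"
proof
  fix D assume "D \<in> model E"
  then obtain M :: "(real^'a) measure" and \<epsilon> \<Lambda> where
    "D = distr M borel (sem_solution \<Lambda> \<epsilon>)" "\<Lambda> \<in> coeff_matrices_star E" "noise_vector M \<epsilon>"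
    unfolding model_def by blast
  then show "D \<in> model (perm_graph \<pi> E)"
    using sem_solution_in_model[OF rearranged_coeffs_star noise_vector_rearranged] assms
    by (metis sem_solution_rearranged)
qed

section \<open>Rademacher noise\<close>

text \<open>As a pmf, an event has positive probability exactly if it meets the support, which turns
  probabilities into existence of sign vectors.\<close>

definition rademacher_pmf :: "('v::finite \<Rightarrow> real) pmf" where
  "rademacher_pmf = Pi_pmf UNIV 0 (\<lambda>_. pmf_of_set {-1, 1})"

lemma set_rademacher_pmf: "set_pmf rademacher_pmf = {\<omega>. \<forall>i. \<omega> i = -1 \<or> \<omega> i = 1}"
  by (auto simp: rademacher_pmf_def set_Pi_pmf PiE_dflt_def)

lemma rademacher_pmf_component: "map_pmf (\<lambda>\<omega>. \<omega> i) rademacher_pmf = pmf_of_set {-1, 1}"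
  by (simp add: rademacher_pmf_def Pi_pmf_component)

lemma noise_vector_rademacher:
  "noise_vector (measure_pmf rademacher_pmf) (\<lambda>\<omega>. (\<chi> i. \<omega> i) :: real^'v::finite)"
proof -
  let ?M = "measure_pmf (rademacher_pmf :: ('v \<Rightarrow> real) pmf)"
  have "prob_space.indep_vars ?M (\<lambda>_. count_space UNIV) (\<lambda>i \<omega>. \<omega> i) UNIV"
    unfolding rademacher_pmf_def by (rule indep_vars_Pi_pmf) simp
  then have "prob_space.indep_vars ?M (\<lambda>_. borel) (\<lambda>i \<omega>. \<omega> i) UNIV"
    by (rule prob_space.indep_vars_compose2[OF measure_pmf.prob_space_axioms]) simp
  moreover have "integrable ?M (\<lambda>\<omega>. \<omega> i)" for i
    by (rule measure_pmf.integrable_const_bound [where B = 1])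
      (auto simp: AE_measure_pmf_iff set_rademacher_pmf, metis abs_1 abs_minus_cancel order_refl)
  moreover have "(\<integral>\<omega>. \<omega> i \<partial>?M) = 0" for i
  proof -
    have "(\<integral>\<omega>. \<omega> i \<partial>?M) = measure_pmf.expectation (map_pmf (\<lambda>\<omega>. \<omega> i) rademacher_pmf) (\<lambda>x. x)"
      by simp
    also have "\<dots> = 0"
      unfolding rademacher_pmf_component by (subst integral_pmf_of_set) auto
    finally show ?thesis .
  qed
  moreover have "\<not> degenerate_rv ?M (\<lambda>\<omega>. \<omega> i)" for i
  proof
    assume "degenerate_rv ?M (\<lambda>\<omega>. \<omega> i)"
    then obtain c where "\<And>\<omega> :: 'v \<Rightarrow> real. \<forall>k. \<omega> k = -1 \<or> \<omega> k = 1 \<Longrightarrow> \<omega> i = c"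
      by (auto simp: degenerate_rv_def AE_measure_pmf_iff set_rademacher_pmf)
    from this[of "\<lambda>_. 1"] this[of "\<lambda>_. -1"] show False by simp
  qed
  moreover have "\<not> gaussian_rv ?M (\<lambda>\<omega>. \<omega> i)" for i
  proof
    assume "gaussian_rv ?M (\<lambda>\<omega>. \<omega> i)"
    then obtain \<mu> \<sigma> where d: "distributed ?M lborel (\<lambda>\<omega>. \<omega> i) (normal_density \<mu> \<sigma>)"
      by (auto simp: gaussian_rv_def)
    \<comment> \<open>A Lebesgue density gives every singleton mass 0, whereas a random sign has an
      atom at 1.\<close>
    have "emeasure ?M ((\<lambda>\<omega>. \<omega> i) -` {1} \<inter> space ?M) = 0"
      by (subst distributed_emeasure[OF d]) (auto simp: nn_integral_null_delta)
    moreover have "(\<lambda>_. 1) \<in> set_pmf (rademacher_pmf :: ('v \<Rightarrow> real) pmf)"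
      by (simp add: set_rademacher_pmf)
    ultimately show False
      by (auto simp: measure_pmf.emeasure_eq_measure measure_pmf_zero_iff)
  qed
  ultimately show ?thesis
    by (auto simp: noise_vector_def measure_pmf.prob_space_axioms)
qed

lemma sum_eq_sum_abs_signs:
  fixes a s :: "'v::finite \<Rightarrow> real"
  assumes "\<And>k. s k = -1 \<or> s k = 1" "(\<Sum>k\<in>UNIV. a k * s k) = (\<Sum>k\<in>UNIV. \<bar>a k\<bar>)"
  shows "a k * s k = \<bar>a k\<bar>"
proof -
  \<comment> \<open>The deficits below the absolute values are nonnegative and sum to 0, so each
    vanishes.\<close>
  have "a k * s k \<le> \<bar>a k\<bar>" for k using assms(1)[of k] by auto
  moreover have "(\<Sum>k\<in>UNIV. \<bar>a k\<bar> - a k * s k) = 0"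
    using assms(2) by (simp add: sum_subtractf)
  ultimately show ?thesis
    by (subst (asm) sum_nonneg_eq_0_iff) auto
qed

text \<open>
  The maximum of row \<open>i\<close> over sign vectors is attained only by those which agree with the signs of
  \<open>A $ i\<close> on its support. If rows \<open>i\<close> and \<open>j\<close> share the column \<open>k\<close>, then the maximum of row \<open>i\<close>
  cannot be combined with both the maximum and the minimum of row \<open>j\<close>, in contrast to independence.
\<close>

lemma independent_rows_disjoint_support:
  fixes A :: "real^'v^'v::finite"
  assumes eq: "distr (measure_pmf rademacher_pmf) borel (\<lambda>\<omega>. A *v (\<chi> i. \<omega> i)) = distr M borel \<epsilon>"
    and \<epsilon>: "noise_vector M \<epsilon>" and "i \<noteq> j"
  shows "A $ i $ k = 0 \<or> A $ j $ k = 0"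
proof -
  interpret prob_space M using \<epsilon> by (simp add: noise_vector_def)
  have [measurable]: "\<epsilon> \<in> borel_measurable M" using \<epsilon> by (simp add: noise_vector_def)
  let ?P = "measure_pmf (rademacher_pmf :: ('v \<Rightarrow> real) pmf)"
  define Y where "Y l \<omega> = (\<Sum>k\<in>UNIV. A $ l $ k * \<omega> k)" for l and \<omega> :: "'v \<Rightarrow> real"
  \<comment> \<open>Events on coordinates of \<open>A *v _\<close> have the same probability as
    those on \<open>\<epsilon>\<close>, where independence is available.\<close>
  have transfer: "measure ?P {\<omega>. \<forall>l\<in>L. Y l \<omega> = v l} = prob (\<Inter>l\<in>L. (\<lambda>\<omega>. \<epsilon> \<omega> $ l) -` {v l} \<inter> space M)"
    if "L \<noteq> {}" for L v
  proof -
    have "closed (\<Inter>l\<in>L. {x :: real^'v. x $ l = v l})"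
      by (intro closed_INT ballI closed_Collect_eq continuous_intros)
    also have "(\<Inter>l\<in>L. {x. x $ l = v l}) = {x. \<forall>l\<in>L. x $ l = v l}" by auto
    finally have S: "{x :: real^'v. \<forall>l\<in>L. x $ l = v l} \<in> sets borel" by simp
    have "measure ?P {\<omega>. \<forall>l\<in>L. Y l \<omega> = v l} =
        measure (distr ?P borel (\<lambda>\<omega>. A *v (\<chi> i. \<omega> i))) {x. \<forall>l\<in>L. x $ l = v l}"
      using S by (subst measure_distr) (auto simp: Y_def matrix_vector_mult_def vimage_def)
    also have "\<dots> = prob (\<epsilon> -` {x. \<forall>l\<in>L. x $ l = v l} \<inter> space M)"
      unfolding eq using S by (subst measure_distr) auto
    also have "\<epsilon> -` {x. \<forall>l\<in>L. x $ l = v l} \<inter> space M = (\<Inter>l\<in>L. (\<lambda>\<omega>. \<epsilon> \<omega> $ l) -` {v l} \<inter> space M)"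
      using that by auto
    finally show ?thesis .
  qed
  \<comment> \<open>Each of the two values has positive probability, hence by independence so does
    the pair; some sign vector therefore attains both.\<close>
  have attained: "\<exists>\<omega>\<in>set_pmf rademacher_pmf. Y i \<omega> = Y i \<omega>\<^sub>1 \<and> Y j \<omega> = Y j \<omega>\<^sub>2"
    if "\<omega>\<^sub>1 \<in> set_pmf rademacher_pmf" "\<omega>\<^sub>2 \<in> set_pmf rademacher_pmf" for \<omega>\<^sub>1 \<omega>\<^sub>2
  proof -
    define v where "v l = (if l = i then Y i \<omega>\<^sub>1 else Y j \<omega>\<^sub>2)" for l
    have "prob (\<Inter>l\<in>{l}. (\<lambda>\<omega>. \<epsilon> \<omega> $ l) -` {v l} \<inter> space M) \<noteq> 0" if "l \<in> {i, j}" for l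
      using that \<open>\<omega>\<^sub>1 \<in> _\<close> \<open>\<omega>\<^sub>2 \<in> _\<close> \<open>i \<noteq> j\<close>
      by (subst transfer [symmetric]) (auto simp: measure_pmf_zero_iff v_def)
    then have "(\<Prod>l\<in>{i, j}. prob ((\<lambda>\<omega>. \<epsilon> \<omega> $ l) -` {v l} \<inter> space M)) \<noteq> 0"
      by simp
    also have "(\<Prod>l\<in>{i, j}. prob ((\<lambda>\<omega>. \<epsilon> \<omega> $ l) -` {v l} \<inter> space M)) =
        prob (\<Inter>l\<in>{i, j}. (\<lambda>\<omega>. \<epsilon> \<omega> $ l) -` {v l} \<inter> space M)"
      using \<epsilon> by (intro indep_varsD [symmetric, of "\<lambda>_. borel" _ UNIV]) (auto simp: noise_vector_def)
    also have "\<dots> = measure ?P {\<omega>. \<forall>l\<in>{i, j}. Y l \<omega> = v l}"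
      by (rule transfer [symmetric]) simp
    finally show ?thesis
      using \<open>i \<noteq> j\<close> by (auto simp: measure_pmf_zero_iff v_def)
  qed
  \<comment> \<open>\<open>s l\<close> maximizes row \<open>l\<close>, and its negative minimizes
    it.\<close>
  define s where "s l k = (if A $ l $ k \<ge> 0 then 1 else -1 :: real)" for l k
  have s: "s l \<in> set_pmf rademacher_pmf" "(\<lambda>k. - s l k) \<in> set_pmf rademacher_pmf" for l
    by (auto simp: s_def set_rademacher_pmf)
  have Ys: "Y l (s l) = (\<Sum>k\<in>UNIV. \<bar>A $ l $ k\<bar>)" "Y l (\<lambda>k. - s l k) = - (\<Sum>k\<in>UNIV. \<bar>A $ l $ k\<bar>)" for l
    by (auto simp: Y_def s_def sum_negf [symmetric] intro!: sum.cong)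
  obtain \<omega> where \<omega>: "\<omega> \<in> set_pmf rademacher_pmf" "Y i \<omega> = Y i (s i)" "Y j \<omega> = Y j (s j)"
    using attained s by blast
  obtain \<omega>' where \<omega>': "\<omega>' \<in> set_pmf rademacher_pmf" "Y i \<omega>' = Y i (s i)" "Y j \<omega>' = Y j (\<lambda>k. - s j k)"
    using attained s by blast
  have sgn: "\<omega> l = -1 \<or> \<omega> l = 1" "\<omega>' l = -1 \<or> \<omega>' l = 1" for l
    using \<omega>(1) \<omega>'(1) by (auto simp: set_rademacher_pmf)
  have ext: "A $ i $ k * \<omega> k = \<bar>A $ i $ k\<bar>" "A $ j $ k * \<omega> k = \<bar>A $ j $ k\<bar>" "A $ i $ k * \<omega>' k = \<bar>A $ i $ k\<bar>"
    using \<omega> \<omega>' sgn by (intro sum_eq_sum_abs_signs; simp add: Ys; simp add: Y_def)+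
  \<comment> \<open>Negating \<open>\<omega>'\<close> turns the minimum of row \<open>j\<close> into
    its maximum.\<close>
  have ext': "A $ j $ k * (- \<omega>' k) = \<bar>A $ j $ k\<bar>"
  proof (rule sum_eq_sum_abs_signs)
    show "- \<omega>' l = -1 \<or> - \<omega>' l = 1" for l using sgn(2)[of l] by auto
    show "(\<Sum>k\<in>UNIV. A $ j $ k * (- \<omega>' k)) = (\<Sum>k\<in>UNIV. \<bar>A $ j $ k\<bar>)"
      using \<omega>'(3) by (simp add: Ys sum_negf) (simp add: Y_def)
  qed
  \<comment> \<open>If the two signs at \<open>k\<close> agree, row \<open>j\<close> needs both
    signs of \<open>A $ j $ k\<close> there, so this entry is 0; if they differ, the same holds for
    row \<open>i\<close>.\<close>
  show ?thesis
  proof (cases "\<omega>' k = \<omega> k")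
    case True
    then have "\<bar>A $ j $ k\<bar> = - \<bar>A $ j $ k\<bar>"
      using ext(2) ext' by (metis mult_minus_right)
    then show ?thesis by simp
  next
    case False
    then have "\<omega>' k = - \<omega> k" using sgn[of k] by auto
    then have "\<bar>A $ i $ k\<bar> = - \<bar>A $ i $ k\<bar>"
      using ext(1,3) by (metis mult_minus_right)
    then show ?thesis by simp
  qed
qed

section \<open>Recovering the permutation\<close>

text \<open>Invertibility gives each row a nonzero entry, and disjoint supports make the choice of
  its column injective, hence bijective. As every column is then chosen by some row, a second
  nonzero entry would collide with that row.\<close>

lemma disjoint_rows_imp_monomial:
  fixes A :: "real^'v^'v::finite"
  assumes "invertible A" and disj: "\<And>i j k. i \<noteq> j \<Longrightarrow> A $ i $ k = 0 \<or> A $ j $ k = 0"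
  obtains \<sigma> where "bij \<sigma>" "\<And>i k. A $ i $ k \<noteq> 0 \<longleftrightarrow> k = \<sigma> i"
proof -
  have "\<exists>k. A $ i $ k \<noteq> 0" for i
  proof (rule ccontr)
    assume z: "\<nexists>k. A $ i $ k \<noteq> 0"
    obtain B where "A ** B = mat 1" using assms(1) by (auto simp: invertible_def)
    then have "(A ** B) $ i $ i = 1" by (simp add: mat_def)
    with z show False by (simp add: matrix_matrix_mult_def)
  qed
  then obtain \<sigma> where \<sigma>: "\<And>i. A $ i $ \<sigma> i \<noteq> 0" by metis
  have "inj \<sigma>" using disj \<sigma> by (metis injI)
  then have "bij \<sigma>" by (simp add: bij_def finite_UNIV_inj_surj)
  moreover have "A $ i $ k \<noteq> 0 \<longleftrightarrow> k = \<sigma> i" for i k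
  proof -
    obtain j where "k = \<sigma> j" using \<open>bij \<sigma>\<close> by (metis bij_pointE)
    then show ?thesis using \<sigma> disj by metis
  qed
  ultimately show ?thesis by (rule that)
qed

lemma coeff_matrices_star_nonempty: "\<exists>\<Lambda>. \<Lambda> \<in> coeff_matrices_star (E :: 'v::finite rel)"
proof -
  define B :: "real^'v^'v" where "B = (\<chi> i j. if (i, j) \<in> E then 1 else 0)"
  have bl: "bounded_linear ((*v) B)" by (rule matrix_vector_mul_bounded_linear)
  \<comment> \<open>Scaling the adjacency matrix to operator norm below 1 makes
    \<open>t *\<^sub>R B\<close> a strict contraction, so \<open>mat 1 - t *\<^sub>R B\<close> has
    trivial kernel.\<close>
  define t where "t = 1 / (onorm ((*v) B) + 1)"
  have o: "onorm ((*v) B) \<ge> 0" by (rule onorm_pos_le[OF bl])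
  have "x = 0" if "(mat 1 - t *\<^sub>R B) *v x = 0" for x
  proof (rule ccontr)
    assume "x \<noteq> 0"
    have "x = t *\<^sub>R (B *v x)"
      using that by (simp add: matrix_vector_mult_diff_rdistrib scaleR_matrix_vector_assoc)
    then have "norm x = t * norm (B *v x)"
      using o by (metis norm_scaleR abs_of_nonneg t_def zero_le_divide_1_iff add_nonneg_nonneg zero_le_one)
    also have "\<dots> \<le> t * (onorm ((*v) B) * norm x)"
      using o by (intro mult_left_mono onorm[OF bl]) (simp add: t_def)
    also have "\<dots> < norm x"
      using o \<open>x \<noteq> 0\<close> by (simp add: t_def field_simps)
    finally show False by simp
  qed
  then have "invertible (mat 1 - t *\<^sub>R B)"
    using matrix_left_invertible_ker invertible_left_inverse by blast
  moreover have "t \<noteq> 0" using o by (simp add: t_def)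
  ultimately have "t *\<^sub>R B \<in> coeff_matrices_star E"
    by (auto simp: coeff_matrices_star_def coeff_matrices_def B_def)
  then show ?thesis ..
qed

lemma column_scaling_imp_perm_graph:
  fixes E E' :: "'v::finite rel"
  assumes irrefl: "irrefl E" "irrefl E'"
    and \<Lambda>: "\<Lambda> \<in> coeff_matrices_star E" and \<Lambda>': "\<Lambda>' \<in> coeff_matrices_star E'"
    and "bij \<sigma>" and c: "\<And>j. c j \<noteq> 0"
    and col: "\<And>i j. (mat 1 - \<Lambda>') $ i $ j = c j * (mat 1 - \<Lambda>) $ i $ \<sigma> j"
  shows "factors_by_cycles \<sigma> E \<and> E' = perm_graph \<sigma> E"
proof -
  have z: "\<Lambda> $ i $ j = 0 \<longleftrightarrow> (i, j) \<notin> E" "\<Lambda>' $ i $ j = 0 \<longleftrightarrow> (i, j) \<notin> E'" for i j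
    using \<Lambda> \<Lambda>' by (auto simp: coeff_matrices_star_def coeff_matrices_def)
  have d: "\<Lambda> $ i $ i = 0" "\<Lambda>' $ i $ i = 0" for i
    using irrefl by (auto simp: z irrefl_def)
  \<comment> \<open>The diagonal entry of \<open>mat 1 - \<Lambda>'\<close> is 1, so the matching
    entry of \<open>mat 1 - \<Lambda>\<close> cannot vanish.\<close>
  have "(j, \<sigma> j) \<in> E" if "\<sigma> j \<noteq> j" for j
    using col[of j j] that z(1)[of j "\<sigma> j"] by (auto simp: mat_def d)
  moreover have "(i, j) \<in> E' \<longleftrightarrow> (i, j) \<in> perm_graph \<sigma> E" for i j
  proof (cases "i = j")
    case True
    then show ?thesis using irrefl by (simp add: perm_graph_def irrefl_def)
  next
    case False
    then have "\<Lambda>' $ i $ j = - (c j * (mat 1 - \<Lambda>) $ i $ \<sigma> j)"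
      using col[of i j] by (simp add: mat_def)
    with False show ?thesis
      using c[of j] z(2)[of i j] z(1)[of i "\<sigma> j"]
      by (cases "i = \<sigma> j") (auto simp: perm_graph_def mat_def d)
  qed
  ultimately show ?thesis
    using \<open>bij \<sigma>\<close> by (auto simp: factors_by_cycles_iff)
qed

lemma model_eq_imp_perm_graph:
  fixes E E' :: "'v::finite rel"
  assumes irrefl: "irrefl E" "irrefl E'" and eq: "model E = model E'"
  shows "\<exists>\<pi>. factors_by_cycles \<pi> E \<and> E' = perm_graph \<pi> E"
proof -
  let ?\<epsilon> = "\<lambda>\<omega>. (\<chi> i. \<omega> i) :: real^'v"
  obtain \<Lambda> where \<Lambda>: "\<Lambda> \<in> coeff_matrices_star E"
    using coeff_matrices_star_nonempty by blast
  have "distr (measure_pmf rademacher_pmf) borel (sem_solution \<Lambda> ?\<epsilon>) \<in> model E'"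
    using sem_solution_in_model[OF \<Lambda> noise_vector_rademacher] eq by simp
  then obtain M :: "(real^'v) measure" and \<epsilon> \<Lambda>' where
    D: "distr (measure_pmf rademacher_pmf) borel (sem_solution \<Lambda> ?\<epsilon>) = distr M borel (sem_solution \<Lambda>' \<epsilon>)"
    and \<Lambda>': "\<Lambda>' \<in> coeff_matrices_star E'" and \<epsilon>: "noise_vector M \<epsilon>"
    unfolding model_def by blast
  have inv: "invertible (mat 1 - \<Lambda>)" "invertible (mat 1 - \<Lambda>')"
    using \<Lambda> \<Lambda>' by (auto simp: coeff_matrices_star_def coeff_matrices_def)
  \<comment> \<open>\<open>A\<close> solves the equations of \<open>E\<close> for given noise and
    then recovers the noise of \<open>E'\<close> from the solution.\<close>
  define A where "A = transpose (mat 1 - \<Lambda>') ** transpose (matrix_inv (mat 1 - \<Lambda>))"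
  have [measurable]: "\<epsilon> \<in> borel_measurable M" using \<epsilon> by (simp add: noise_vector_def)
  have [measurable]: "sem_solution \<Lambda>' \<epsilon> \<in> borel_measurable M"
    unfolding sem_solution_def [abs_def]
    by (rule measurable_compose[OF _ borel_measurable_matrix_vector_mult]) simp
  have "distr (measure_pmf rademacher_pmf) borel (\<lambda>\<omega>. A *v ?\<epsilon> \<omega>) =
      distr (distr (measure_pmf rademacher_pmf) borel (sem_solution \<Lambda> ?\<epsilon>)) borel
        (\<lambda>x. transpose (mat 1 - \<Lambda>') *v x)"
    by (subst distr_distr)
      (auto simp: comp_def A_def sem_solution_def borel_measurable_matrix_vector_mult
        matrix_vector_mul_assoc simp del: transpose_matrix_vector)
  also have "\<dots> = distr M borel (\<lambda>\<omega>. transpose (mat 1 - \<Lambda>') *v sem_solution \<Lambda>' \<epsilon> \<omega>)"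
    unfolding D
    by (subst distr_distr)
      (auto simp: comp_def borel_measurable_matrix_vector_mult simp del: transpose_matrix_vector)
  also have "(\<lambda>\<omega>. transpose (mat 1 - \<Lambda>') *v sem_solution \<Lambda>' \<epsilon> \<omega>) = \<epsilon>"
    using sem_solution_eq_iff[OF inv(2), of \<epsilon>] by blast
  finally have disj: "A $ i $ k = 0 \<or> A $ j $ k = 0" if "i \<noteq> j" for i j k
    using independent_rows_disjoint_support[OF _ \<epsilon> that] by blast
  have "transpose (matrix_inv (mat 1 - \<Lambda>)) ** transpose (mat 1 - \<Lambda>) = mat 1"
    using inv(1) by (simp add: matrix_inv_mult transpose_mat flip: matrix_transpose_mul)
  then have A: "A ** transpose (mat 1 - \<Lambda>) = transpose (mat 1 - \<Lambda>')"
    by (simp add: A_def flip: matrix_mul_assoc)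
  have "invertible (matrix_inv (mat 1 - \<Lambda>))"
    using inv(1) matrix_inv_mult unfolding invertible_def by blast
  then have "invertible A"
    unfolding A_def using inv(2) by (intro invertible_mult transpose_invertible)
  then obtain \<sigma> where "bij \<sigma>" and \<sigma>: "\<And>i k. A $ i $ k \<noteq> 0 \<longleftrightarrow> k = \<sigma> i"
  proof (rule disjoint_rows_imp_monomial)
    show "A $ i $ k = 0 \<or> A $ j $ k = 0" if "i \<noteq> j" for i j k using that by (rule disj)
  qed (rule that)
  have "(mat 1 - \<Lambda>') $ i $ j = A $ j $ \<sigma> j * (mat 1 - \<Lambda>) $ i $ \<sigma> j" for i j
  proof -
    \<comment> \<open>Entry \<open>(j, i)\<close> of the identity \<open>A\<close>; only the column
      \<open>\<sigma> j\<close> survives in row \<open>j\<close> of \<open>A\<close>.\<close>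
    have "(mat 1 - \<Lambda>') $ i $ j = (\<Sum>k\<in>UNIV. A $ j $ k * (mat 1 - \<Lambda>) $ i $ k)"
      using arg_cong[OF A, of "\<lambda>B. B $ j $ i"]
      by (simp add: matrix_matrix_mult_def transpose_def)
    also have "\<dots> = (\<Sum>k\<in>{\<sigma> j}. A $ j $ k * (mat 1 - \<Lambda>) $ i $ k)"
      using \<sigma> by (intro sum.mono_neutral_right) auto
    finally show ?thesis by simp
  qed
  with \<sigma> show ?thesis
    using column_scaling_imp_perm_graph[OF irrefl \<Lambda> \<Lambda>' \<open>bij \<sigma>\<close>, of "\<lambda>j. A $ j $ \<sigma> j"] by blast
qed

theorem theorem3p5:
  fixes E E' :: "('v::finite) rel"
  assumes "irrefl E" and "irrefl E'"
  shows "(distribution_equivalent E E' \<longleftrightarrow>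
            (\<exists>\<pi>. factors_by_cycles \<pi> E \<and> E' = perm_graph \<pi> E)) \<and>
         (\<forall>\<pi> \<Lambda> (M :: 'a measure) \<epsilon>.
            factors_by_cycles \<pi> E \<and> E' = perm_graph \<pi> E \<and>
            \<Lambda> \<in> coeff_matrices_star E \<and> noise_vector M \<epsilon> \<longrightarrow>
            (\<exists>\<Lambda>' \<epsilon>'.
               rearranged_equations M \<pi> \<Lambda> \<epsilon> \<Lambda>' \<epsilon>' \<and>
               \<Lambda>' \<in> coeff_matrices_star E' \<and> noise_vector M \<epsilon>' \<and>
               distr M borel (sem_solution \<Lambda>' \<epsilon>') = distr M borel (sem_solution \<Lambda> \<epsilon>) \<and>
               (\<forall>\<Lambda>'' \<epsilon>''. rearranged_equations M \<pi> \<Lambda> \<epsilon> \<Lambda>'' \<epsilon>'' \<longrightarrow>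
                  \<Lambda>'' = \<Lambda>' \<and> (\<forall>\<omega>\<in>space M. \<epsilon>'' \<omega> = \<epsilon>' \<omega>))))"
proof (intro conjI iffI allI impI)
  assume "distribution_equivalent E E'"
  then show "\<exists>\<pi>. factors_by_cycles \<pi> E \<and> E' = perm_graph \<pi> E"
    using model_eq_imp_perm_graph[OF assms] by (simp add: distribution_equivalent_def)
next
  assume "\<exists>\<pi>. factors_by_cycles \<pi> E \<and> E' = perm_graph \<pi> E"
  then obtain \<pi> where \<pi>: "factors_by_cycles \<pi> E" and E': "E' = perm_graph \<pi> E" by blast
  \<comment> \<open>The same inclusion, applied to \<open>E'\<close> and \<open>inv \<pi>\<close>,
    which lead back to \<open>E\<close>.\<close>
  have "model E' \<subseteq> model E"
    using model_subset_perm_graph[OF assms(2), of "inv \<pi>"]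
      factors_by_cycles_inv_perm_graph[OF assms(1) \<pi>] by (simp add: E')
  then show "distribution_equivalent E E'"
    using model_subset_perm_graph[OF assms(1) \<pi>] by (simp add: distribution_equivalent_def E')
next
  fix \<pi> \<Lambda> and M :: "'a measure" and \<epsilon> :: "'a \<Rightarrow> real^'v"
  assume "factors_by_cycles \<pi> E \<and> E' = perm_graph \<pi> E \<and>
    \<Lambda> \<in> coeff_matrices_star E \<and> noise_vector M \<epsilon>"
  then have \<pi>: "factors_by_cycles \<pi> E" and E': "E' = perm_graph \<pi> E"
    and \<Lambda>: "\<Lambda> \<in> coeff_matrices_star E" and \<epsilon>: "noise_vector M \<epsilon>" by auto
  note hyps = assms(1) \<pi> \<Lambda>
  have "prob_space M" using \<epsilon> by (simp add: noise_vector_def)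
  show "\<exists>\<Lambda>' \<epsilon>'. rearranged_equations M \<pi> \<Lambda> \<epsilon> \<Lambda>' \<epsilon>' \<and>
      \<Lambda>' \<in> coeff_matrices_star E' \<and> noise_vector M \<epsilon>' \<and>
      distr M borel (sem_solution \<Lambda>' \<epsilon>') = distr M borel (sem_solution \<Lambda> \<epsilon>) \<and>
      (\<forall>\<Lambda>'' \<epsilon>''. rearranged_equations M \<pi> \<Lambda> \<epsilon> \<Lambda>'' \<epsilon>'' \<longrightarrow>
         \<Lambda>'' = \<Lambda>' \<and> (\<forall>\<omega>\<in>space M. \<epsilon>'' \<omega> = \<epsilon>' \<omega>))"
    unfolding E'
    using rearranged_equations_rearranged[OF hyps] rearranged_coeffs_star[OF hyps]
      noise_vector_rearranged[OF hyps \<epsilon>]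
      rearranged_equations_unique[OF \<open>prob_space M\<close> rearranged_equations_rearranged[OF hyps]]
    by (intro exI[of _ "rearranged_coeffs \<pi> \<Lambda>"] exI[of _ "rearranged_noise \<pi> \<Lambda> \<epsilon>"] conjI allI impI)
      (auto simp: sem_solution_rearranged[OF hyps])
qed

end
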